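(* Let $H$ be a bipartite graph and let $G$ be the complement of $H$. If $G$ contains no induced subgraph isomorphic to $C_4$, then $\chi_{FF}(G)\geq \delta(G)+1$.
   Context: All graphs are finite, simple and undirected. $C_4$ is the cycle on 4 vertices; the complement $\overline{H}$ has the same vertex set as $H$, with two distinct vertices adjacent iff they are non-adjacent in $H$. $\delta(G)$ is the minimum degree. A Grundy $k$-coloring of $G$ is a proper coloring with colors $\{1,\dots,k\}$ such that for any $i<j$, every vertex colored $j$ has a neighbor colored $i$; $\chi_{FF}(G)$ (the First-Fit or Grundy chromatic number) is the largest $k$ for which a Grundy $k$-coloring exists. *)

theory Defs
  imports "Graph_Theory.Graph_Theory"
begin

text \<open>
  Finite simple undirected graphs are modelled by \<open>pair_graph\<close>: finite, loop-free, symmetric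
  digraphs whose arcs are pairs of vertices. An undirected edge \<open>uv\<close> is thus represented by
  the two arcs \<open>(u, v)\<close> and \<open>(v, u)\<close>.
\<close>

definition graph_complement :: "'a pair_pre_digraph \<Rightarrow> 'a pair_pre_digraph" where
  "graph_complement H = \<lparr> pverts = pverts H,
     parcs = {(u, v). u \<in> pverts H \<and> v \<in> pverts H \<and> u \<noteq> v \<and> (u, v) \<notin> parcs H} \<rparr>"

definition bipartite :: "'a pair_pre_digraph \<Rightarrow> bool" where
  "bipartite H \<longleftrightarrow> (\<exists>A B. pverts H = A \<union> B \<and> A \<inter> B = {} \<and> parcs H \<subseteq> A \<times> B \<union> B \<times> A)"

definition cycle4 :: "nat pair_pre_digraph" where
  "cycle4 = \<lparr> pverts = {..<4},
     parcs = {(i, j). i < 4 \<and> j < 4 \<and> (j = (i + 1) mod 4 \<or> i = (j + 1) mod 4)} \<rparr>"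

definition has_induced_copy :: "'b pair_pre_digraph \<Rightarrow> 'a pair_pre_digraph \<Rightarrow> bool" where
  "has_induced_copy F G \<longleftrightarrow>
     (\<exists>K. induced_subgraph K (with_proj G) \<and> digraph_iso K (with_proj F))"

text \<open>
  In a symmetric digraph the out-degree of a vertex is its number of neighbours. The minimum is
  meaningful for finite graphs with at least one vertex.
\<close>

definition min_degree :: "'a pair_pre_digraph \<Rightarrow> nat" where
  "min_degree G = Min (out_degree (with_proj G) ` pverts G)"

text \<open>
  All colors \<open>1, \<dots>, k\<close> have to occur: otherwise unused colors above the occurring ones could be
  added freely, and there would be no largest \<open>k\<close>.
\<close>

definition grundy_coloring :: "'a pair_pre_digraph \<Rightarrow> nat \<Rightarrow> ('a \<Rightarrow> nat) \<Rightarrow> bool" where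
  "grundy_coloring G k c \<longleftrightarrow>
     c ` pverts G = {1..k} \<and>
     (\<forall>(u, v) \<in> parcs G. c u \<noteq> c v) \<and>
     (\<forall>i \<in> {1..k}. \<forall>j \<in> {1..k}. i < j \<longrightarrow>
        (\<forall>v \<in> pverts G. c v = j \<longrightarrow> (\<exists>u \<in> pverts G. (v, u) \<in> parcs G \<and> c u = i)))"

definition grundy_number :: "'a pair_pre_digraph \<Rightarrow> nat" where
  "grundy_number G = Max {k. \<exists>c. grundy_coloring G k c}"

lemma pair_graph_graph_complement:
  assumes "pair_graph H"
  shows "pair_graph (graph_complement H)"
proof -
  interpret pair_graph H by fact
  have "finite (parcs (graph_complement H))"
    by (rule finite_subset[of _ "pverts H \<times> pverts H"])
      (auto simp: graph_complement_def pair_finite_verts)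
  moreover have "(v, u) \<in> parcs H" if "(u, v) \<in> parcs H" for u v
    using that pair_sym_arcs by (auto simp: symmetric_def dest: symD)
  ultimately show ?thesis
    by unfold_locales
      (auto simp: graph_complement_def symmetric_def pair_finite_verts intro!: symI)
qed

lemma pair_graph_cycle4: "pair_graph cycle4"
proof -
  have "finite (parcs cycle4)"
    by (rule finite_subset[of _ "{..<4} \<times> {..<4}"]) (auto simp: cycle4_def)
  moreover have "Suc i mod 4 \<noteq> i" if "i < 4" for i :: nat
    using that by presburger
  ultimately show ?thesis
    by unfold_locales (auto simp: cycle4_def symmetric_def intro!: symI dest: sym)
qed

lemma grundy_coloring_le_card:
  assumes "finite (pverts G)" "grundy_coloring G k c"
  shows "k \<le> card (pverts G)"
  using assms card_image_le[of "pverts G" c] by (simp add: grundy_coloring_def)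

lemma finite_grundy_colorings:
  assumes "finite (pverts G)"
  shows "finite {k. \<exists>c. grundy_coloring G k c}"
  by (rule finite_subset[of _ "{..card (pverts G)}"])
    (use grundy_coloring_le_card[OF assms] in auto)

end

theory Submission
  imports Defs
begin

text \<open>
  In a \<open>C\<^sub>4\<close>-free complement of a bipartite graph, the closed neighbourhood of a vertex \<open>v\<close> of
  minimum degree is a clique: a pair \<open>x, y\<close> of non-adjacent vertices in it would lie on
  different sides of the bipartition, say with \<open>x\<close> on the side of \<open>v\<close>, and since \<open>x\<close> has at least
  as many neighbours as \<open>v\<close>, some \<open>z\<close> is adjacent to \<open>x\<close> but not to \<open>v\<close>; then \<open>v, x, z, y\<close> is an
  induced \<open>C\<^sub>4\<close>. A Grundy coloring exists (color greedily) and uses distinct colors on that clique.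
\<close>

text \<open>\<open>digraph_iso\<close> asks for an isomorphism from the induced subgraph to
  \<open>F\<close>, whereas the embedding \<open>f\<close> goes the other way. So the induced
  subgraph is recognised as the image of \<open>F\<close> under \<open>f\<close>, and the inverse
  isomorphism is used.\<close>

lemma has_induced_copyI:
  assumes F: "pair_wf_digraph F" and G: "pair_wf_digraph G"
    and inj: "inj_on f (pverts F)" and im: "f ` pverts F \<subseteq> pverts G"
    and arcs: "\<And>u v. u \<in> pverts F \<Longrightarrow> v \<in> pverts F \<Longrightarrow> (f u, f v) \<in> parcs G \<longleftrightarrow> (u, v) \<in> parcs F"
  shows "has_induced_copy F G"
proof -
  interpret F: pair_wf_digraph F by fact
  interpret G: pair_wf_digraph G by fact
  define K where "K = with_proj G \<restriction> (f ` pverts F)"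
  define hom where "hom = \<lparr> iso_verts = f, iso_arcs = map_prod f f, iso_head = snd, iso_tail = fst \<rparr>"
  have sub: "parcs F \<subseteq> pverts F \<times> pverts F"
    using F.in_arcsD1 F.in_arcsD2 by auto
  have "inj_on (map_prod f f) (parcs F)"
    by (rule inj_on_subset[OF map_prod_inj_on[OF inj inj] sub])
  then have hom: "F.digraph_isomorphism hom"
    unfolding F.digraph_isomorphism_def hom_def
    using inj F.wf_digraph by auto
  \<comment> \<open>The two directions of \<open>arcs\<close> give the two inclusions; that arcs of
    \<open>G\<close> within the image come from arcs of \<open>F\<close> is what makes the copy
    induced.\<close>
  have "map_prod f f ` parcs F = {e \<in> parcs G. fst e \<in> f ` pverts F \<and> snd e \<in> f ` pverts F}"
  proof (intro equalityI subsetI)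
    fix e assume "e \<in> map_prod f f ` parcs F"
    then show "e \<in> {e \<in> parcs G. fst e \<in> f ` pverts F \<and> snd e \<in> f ` pverts F}"
      using sub arcs by auto
  next
    fix e assume "e \<in> {e \<in> parcs G. fst e \<in> f ` pverts F \<and> snd e \<in> f ` pverts F}"
    then obtain u v where "u \<in> pverts F" "v \<in> pverts F" "e = (f u, f v)" "e \<in> parcs G"
      by (cases e) auto
    then show "e \<in> map_prod f f ` parcs F"
      using arcs by (auto intro!: image_eqI[of _ _ "(u, v)"])
  qed
  then have K: "K = app_iso hom (with_proj F)"
    by (simp add: K_def app_iso_def hom_def induce_subgraph_def)
  have "with_proj F = app_iso (F.inv_iso hom) K"
    using hom by (simp add: K)
  moreover have "pre_digraph.digraph_isomorphism K (F.inv_iso hom)"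
    unfolding K by (rule F.digraph_isomorphism_invI[OF hom])
  ultimately have "digraph_iso K (with_proj F)"
    unfolding digraph_iso_def by blast
  moreover have "induced_subgraph K (with_proj G)"
    unfolding K_def using im by (intro G.induced_induce) simp
  ultimately show ?thesis
    unfolding has_induced_copy_def by blast
qed

lemma has_induced_copy_cycle4I:
  assumes "pair_graph G"
    and V: "{a, b, c, d} \<subseteq> pverts G"
    and adj: "(a, b) \<in> parcs G" "(b, c) \<in> parcs G" "(c, d) \<in> parcs G" "(d, a) \<in> parcs G"
    and nadj: "(a, c) \<notin> parcs G" "(b, d) \<notin> parcs G"
    and ne: "a \<noteq> c" "b \<noteq> d"
  shows "has_induced_copy cycle4 G"
proof -
  interpret G: pair_graph G by fact
  interpret C: pair_graph cycle4 by (rule pair_graph_cycle4)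
  have sym: "(v, u) \<in> parcs G" if "(u, v) \<in> parcs G" for u v
    using that G.pair_sym_arcs by (auto simp: symmetric_def dest: symD)
  have nadj': "(c, a) \<notin> parcs G" "(d, b) \<notin> parcs G"
    using nadj sym by blast+
  have loop: "(u, u) \<notin> parcs G" for u
    using G.pair_no_loops by fastforce
  have four: "pverts cycle4 = {0, 1, 2, 3}"
    by (auto simp: cycle4_def)
  have arc: "(i, j) \<in> parcs cycle4 \<longleftrightarrow> i < 4 \<and> j < 4 \<and> (j = (i + 1) mod 4 \<or> i = (j + 1) mod 4)" for i j
    by (simp add: cycle4_def)
  let ?f = "\<lambda>i. [a, b, c, d] ! i"
  \<comment> \<open>Consecutive vertices differ because \<open>G\<close> has no loops, opposite ones
    by \<open>ne\<close>.\<close>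
  have dist: "distinct [a, b, c, d]"
    using adj ne loop by auto
  show ?thesis
  proof (rule has_induced_copyI[where f = ?f])
    show "inj_on ?f (pverts cycle4)"
      using dist by (auto simp: four inj_on_def)
    show "?f ` pverts cycle4 \<subseteq> pverts G"
      using V by (auto simp: four)
    show "(?f i, ?f j) \<in> parcs G \<longleftrightarrow> (i, j) \<in> parcs cycle4"
      if "i \<in> pverts cycle4" "j \<in> pverts cycle4" for i j
      using that unfolding four insert_iff empty_iff
      by (elim disjE) (simp_all add: arc adj adj[THEN sym] nadj nadj' loop)
  qed unfold_locales
qed

text \<open>First-Fit, by induction on \<open>V\<close>: the new vertex gets the least color absent
  from its neighbours in \<open>V\<close>, and all others keep their colors. The relation
  \<open>E\<close> stays fixed and is cut down to \<open>V\<close>, so that the induction hypothesis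
  speaks of the subgraph without the new vertex.\<close>

lemma ex_grundy_coloring_restrict:
  assumes "finite V" and "sym E" and "irrefl E"
  shows "\<exists>k c. grundy_coloring \<lparr> pverts = V, parcs = E \<inter> V \<times> V \<rparr> k c"
  using \<open>finite V\<close>
proof (induction V)
  case empty
  then show ?case
    by (auto simp: grundy_coloring_def)
next
  case (insert v V)
  then obtain k c where c: "grundy_coloring \<lparr> pverts = V, parcs = E \<inter> V \<times> V \<rparr> k c"
    by blast
  have im: "c ` V = {1..k}"
    using c by (simp add: grundy_coloring_def)
  have proper: "c x \<noteq> c y" if "x \<in> V" "y \<in> V" "(x, y) \<in> E" for x y
    using c that by (auto simp: grundy_coloring_def)
  have greedy: "\<exists>u\<in>V. (x, u) \<in> E \<and> c u = i" if "x \<in> V" "1 \<le> i" "i < c x" for x i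
  proof -
    have "c x \<in> {1..k}"
      using im that(1) by blast
    then have "i \<in> {1..k}"
      using that by simp
    moreover have "\<forall>i\<in>{1..k}. \<forall>j\<in>{1..k}. i < j \<longrightarrow>
        (\<forall>x\<in>V. c x = j \<longrightarrow> (\<exists>u\<in>V. (x, u) \<in> E \<inter> V \<times> V \<and> c u = i))"
      using c unfolding grundy_coloring_def pair_pre_digraph.simps by (elim conjE)
    ultimately show ?thesis
      using that \<open>c x \<in> {1..k}\<close> by blast
  qed
  define free where "free i \<longleftrightarrow> 1 \<le> i \<and> (\<forall>u\<in>V. (v, u) \<in> E \<longrightarrow> c u \<noteq> i)" for i
  define m where "m = (LEAST i. free i)"
  \<comment> \<open>No vertex of \<open>V\<close> has color \<open>k + 1\<close>, so a free color
    exists and the least one exceeds \<open>k\<close> by at most one.\<close>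
  have k: "free (Suc k)"
    using im by (force simp: free_def)
  then have m: "free m" "m \<le> Suc k"
    unfolding m_def by (auto intro: LeastI Least_le)
  have below: "\<exists>u\<in>V. (v, u) \<in> E \<and> c u = i" if "1 \<le> i" "i < m" for i
    using not_less_Least[of i free] that by (auto simp: m_def free_def)
  let ?c = "c(v := m)" and ?k = "max k m"
  have old: "?c u = c u" if "u \<in> V" for u
    using that insert.hyps by auto
  have "?c ` insert v V = insert m (c ` V)"
    unfolding fun_upd_image using insert.hyps by simp
  \<comment> \<open>No gap arises: either \<open>m\<close> is an old color or it extends the
    interval by one.\<close>
  also have "\<dots> = {1..?k}"
    using m by (auto simp: im free_def)
  finally have im': "?c ` insert v V = {1..?k}" .
  have proper': "?c x \<noteq> ?c y" if "x \<in> insert v V" "y \<in> insert v V" "(x, y) \<in> E" for x y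
    using that m(1) proper old assms(2,3) insert.hyps
    by (auto simp: free_def irrefl_def dest: symD)
  have greedy': "\<exists>u\<in>insert v V. (x, u) \<in> E \<and> ?c u = i"
    if "x \<in> insert v V" "1 \<le> i" "i < ?c x" for x i
  proof (cases "x = v")
    case True
    then show ?thesis
      using below[of i] that old by auto
  next
    case False
    then show ?thesis
      using greedy[of x i] that old by auto
  qed
  have "grundy_coloring \<lparr> pverts = insert v V, parcs = E \<inter> insert v V \<times> insert v V \<rparr> ?k ?c"
    unfolding grundy_coloring_def pair_pre_digraph.simps
  proof (intro conjI ballI impI)
    show "?c ` insert v V = {1..?k}" by (rule im')
  next
    fix e assume "e \<in> E \<inter> insert v V \<times> insert v V"
    then show "case e of (x, y) \<Rightarrow> ?c x \<noteq> ?c y"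
      using proper' by blast
  next
    fix i j x assume "i \<in> {1..?k}" "i < j" "x \<in> insert v V" "?c x = j"
    then show "\<exists>u\<in>insert v V. (x, u) \<in> E \<inter> insert v V \<times> insert v V \<and> ?c u = i"
      using greedy'[of x i] by auto
  qed
  then show ?case by blast
qed

lemma ex_grundy_coloring:
  assumes "pair_graph G"
  shows "\<exists>k c. grundy_coloring G k c"
proof -
  interpret pair_graph G by fact
  have "parcs G \<inter> pverts G \<times> pverts G = parcs G"
    using in_arcsD1 in_arcsD2 by auto
  moreover have "irrefl (parcs G)"
    using pair_no_loops by (fastforce simp: irrefl_def)
  moreover have "sym (parcs G)"
    using pair_sym_arcs by (simp add: symmetric_def)
  moreover have "\<lparr> pverts = pverts G, parcs = parcs G \<rparr> = G"
    by simp
  ultimately show ?thesis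
    using ex_grundy_coloring_restrict[of "pverts G" "parcs G"] pair_finite_verts by metis
qed

lemma card_clique_le_grundy_number:
  assumes "pair_graph G" and "S \<subseteq> pverts G"
    and clique: "\<And>x y. x \<in> S \<Longrightarrow> y \<in> S \<Longrightarrow> x \<noteq> y \<Longrightarrow> (x, y) \<in> parcs G"
  shows "card S \<le> grundy_number G"
proof -
  interpret pair_graph G by fact
  obtain k c where c: "grundy_coloring G k c"
    using ex_grundy_coloring[OF \<open>pair_graph G\<close>] by blast
  then have "c x \<noteq> c y" if "(x, y) \<in> parcs G" for x y
    using that by (auto simp: grundy_coloring_def)
  then have "inj_on c S"
    using clique by (meson inj_onI)
  moreover have "c ` S \<subseteq> {1..k}"
    using c \<open>S \<subseteq> pverts G\<close> by (auto simp: grundy_coloring_def)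
  ultimately have "card S \<le> k"
    using card_inj_on_le[of c S "{1..k}"] by simp
  \<comment> \<open>The maximum is over a bounded set: all \<open>k\<close> colors occur, so
    \<open>k\<close> is at most the number of vertices.\<close>
  also have "k \<le> grundy_number G"
    unfolding grundy_number_def
    using c by (intro Max_ge finite_grundy_colorings pair_finite_verts) auto
  finally show ?thesis .
qed

lemma out_degree_with_proj:
  "out_degree (with_proj G) v = card {u. (v, u) \<in> parcs G}"
proof -
  have "out_arcs (with_proj G) v = Pair v ` {u. (v, u) \<in> parcs G}"
    by (auto simp: out_arcs_def)
  then show ?thesis
    by (simp add: out_degree_def card_image inj_on_def)
qed

theorem theorem9:
  fixes H G :: "'a pair_pre_digraph"
  assumes "pair_graph H"
    and "pverts H \<noteq> {}"
    and "bipartite H"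
    and "G = graph_complement H"
    and "\<not> has_induced_copy cycle4 G"
  shows "grundy_number G \<ge> min_degree G + 1"
proof -
  have G: "pair_graph G"
    using pair_graph_graph_complement[OF assms(1)] assms(4) by simp
  then interpret pair_graph G .
  define N where "N v = {u. (v, u) \<in> parcs G}" for v
  have sym: "(y, x) \<in> parcs G" if "(x, y) \<in> parcs G" for x y
    using that pair_sym_arcs by (auto simp: symmetric_def dest: symD)
  have loop: "(x, x) \<notin> parcs G" for x
    using pair_no_loops by fastforce
  have N_sub: "N v \<subseteq> pverts G" for v
    using in_arcsD2 by (auto simp: N_def)
  then have fin: "finite (N v)" for v
    using finite_subset pair_finite_verts by blast
  have deg: "min_degree G = Min ((\<lambda>v. card (N v)) ` pverts G)"
    by (simp add: min_degree_def out_degree_with_proj N_def)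
  also have "\<dots> \<in> (\<lambda>v. card (N v)) ` pverts G"
    using assms(2,4) pair_finite_verts by (intro Min_in) (auto simp: graph_complement_def)
  finally obtain v where v: "v \<in> pverts G" "min_degree G = card (N v)"
    by blast
  have min: "card (N v) \<le> card (N x)" if "x \<in> pverts G" for x
    using that pair_finite_verts deg v(2) by simp
  from assms(3) obtain A B where AB: "pverts H = A \<union> B" "A \<inter> B = {}" "parcs H \<subseteq> A \<times> B \<union> B \<times> A"
    by (auto simp: bipartite_def)
  \<comment> \<open>Both sides of the bipartition are cliques of \<open>G\<close>. As they partition
    the vertices, agreement on membership in \<open>A\<close> covers the side \<open>B\<close> as
    well.\<close>
  have same_side: "(x, y) \<in> parcs G"
    if "x \<in> pverts G" "y \<in> pverts G" "x \<noteq> y" "x \<in> A \<longleftrightarrow> y \<in> A" for x y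
    using that AB assms(4) by (auto simp: graph_complement_def)
  \<comment> \<open>Only the case with \<open>x\<close> on the side of \<open>v\<close> is treated
    here; at the end \<open>key\<close> is available for both orders of a non-adjacent pair.\<close>
  have key: False
    if x: "x \<in> insert v (N v)" and y: "y \<in> insert v (N v)" and "x \<noteq> y"
      and xy: "(x, y) \<notin> parcs G" and side: "x \<in> A \<longleftrightarrow> v \<in> A" for x y
  proof -
    have V: "x \<in> pverts G" "y \<in> pverts G"
      using x y v(1) N_sub by auto
    have "x \<noteq> v" "y \<noteq> v" "(v, x) \<in> parcs G" "(v, y) \<in> parcs G"
      using x y \<open>x \<noteq> y\<close> xy sym[of v x] by (auto simp: N_def)
    \<comment> \<open>The mutual neighbours \<open>x\<close> and \<open>v\<close> are removed before
      comparing. An inclusion would be strict, as \<open>y\<close> is adjacent to \<open>v\<close>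
      but not to \<open>x\<close>, so \<open>x\<close> would have smaller degree than
      \<open>v\<close>.\<close>
    have "\<not> N x - {v} \<subseteq> N v - {x}"
    proof
      assume "N x - {v} \<subseteq> N v - {x}"
      then have "N x - {v} \<subset> N v - {x}"
        using \<open>(v, y) \<in> parcs G\<close> \<open>x \<noteq> y\<close> xy by (auto simp: N_def)
      then have "card (N x - {v}) < card (N v - {x})"
        using fin by (intro psubset_card_mono) auto
      then show False
        using min[OF V(1)] fin \<open>(v, x) \<in> parcs G\<close> sym[of v x] by (auto simp: N_def)
    qed
    then obtain z where z: "(x, z) \<in> parcs G" "(v, z) \<notin> parcs G" "z \<noteq> v"
      using loop by (auto simp: N_def)
    have zV: "z \<in> pverts G"
      using z(1) N_sub by (auto simp: N_def)
    \<comment> \<open>Distinct non-adjacent vertices of \<open>G\<close> lie on different sides.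
      Hence \<open>y\<close>, not adjacent to \<open>x\<close>, and \<open>z\<close>, not adjacent
      to \<open>v\<close>, both lie opposite \<open>v\<close>. They differ because \<open>x\<close>
      is adjacent to \<open>z\<close> but not to \<open>y\<close>, so they are adjacent.\<close>
    have "y \<in> A \<longleftrightarrow> v \<notin> A" "z \<in> A \<longleftrightarrow> v \<notin> A"
      using same_side[of x y] same_side[of v z] V zV v(1) side xy z \<open>x \<noteq> y\<close> by auto
    then have "(z, y) \<in> parcs G"
      using same_side[of z y] zV V(2) z(1) xy by auto
    then have "has_induced_copy cycle4 G"
      using G V zV v(1) z xy \<open>x \<noteq> y\<close> \<open>(v, x) \<in> parcs G\<close> \<open>(v, y) \<in> parcs G\<close> sym[of v y]
      by (intro has_induced_copy_cycle4I[of G v x z y]) auto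
    then show False
      using assms(5) by blast
  qed
  have "(x, y) \<in> parcs G" if "x \<in> insert v (N v)" "y \<in> insert v (N v)" "x \<noteq> y" for x y
  proof (rule ccontr)
    assume xy: "(x, y) \<notin> parcs G"
    then have "x \<in> A \<longleftrightarrow> y \<notin> A"
      using same_side[of x y] that v(1) N_sub by blast
    then consider "x \<in> A \<longleftrightarrow> v \<in> A" | "y \<in> A \<longleftrightarrow> v \<in> A"
      by blast
    then show False
      using key[of x y] key[of y x] that xy sym by cases blast+
  qed
  then have "card (insert v (N v)) \<le> grundy_number G"
    using v(1) N_sub by (intro card_clique_le_grundy_number[OF G]) auto
  \<comment> \<open>The summand 1 counts \<open>v\<close> itself, which is not in \<open>N v\<close>
    since there are no loops.\<close>
  then show ?thesis
    using v(2) fin loop by (simp add: N_def)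
qed

end
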